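(* Let $f:\Omega\subseteq\mathbb{E}_2\to\mathbb{R}$, let $\mathbf{a},\mathbf{b},\mathbf{c}\in\Omega$ be not collinear, and suppose that the mirrored point $\bar{\mathbf{a}}$ of $\mathbf{a}$ through the line passing through $\mathbf{b}$ and $\mathbf{c}$ lies in $\Omega$. Let $\overline{\mathbf{r}}_{f_{(\mathbf{a},\mathbf{b},\mathbf{c})}}=\big(\overline{\mathbf{\Delta}}f_{(\mathbf{a},\mathbf{b},\mathbf{c})}\big)\big(\Delta_{(\mathbf{a},\mathbf{b},\mathbf{c})}\big)^{-1}$, computed in the Clifford algebra $\mathbb{G}_2$. Then $$\overline{\mathbf{r}}_{f_{(\mathbf{a},\mathbf{b},\mathbf{c})}}=\frac{f(\bar{\mathbf{a}})-f(\mathbf{a})}{\bar{\mathbf{a}}-\mathbf{a}}+\frac{f(\mathbf{c})-f(\mathbf{b})}{\mathbf{c}-\mathbf{b}}.$$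
   Context: $\mathbb{E}_2$ is the two-dimensional real Euclidean vector space with scalar product $\mathbf{u}\cdot\mathbf{v}$; its vectors are also called points. $\mathbb{G}_2=\mathcal{C}\ell(\mathbb{E}_2)$ is the Clifford (geometric) algebra generated by $\mathbb{E}_2$, an associative algebra of dimension $4$ with product denoted by juxtaposition and $\mathbf{v}\mathbf{v}=\mathbf{v}\cdot\mathbf{v}$ for every vector $\mathbf{v}$. For vectors, $\mathbf{u}\wedge\mathbf{v}=\frac12(\mathbf{u}\mathbf{v}-\mathbf{v}\mathbf{u})$. For $\alpha\in\mathbb{R}$ and a non-zero vector $\mathbf{v}$, $\frac{\alpha}{\mathbf{v}}=\alpha\mathbf{v}^{-1}=\frac{\alpha}{|\mathbf{v}|^2}\mathbf{v}$. Not collinear means that $\mathbf{a},\mathbf{b},\mathbf{c}$ are the vertices of a non degenerate triangle. Define $\Delta_{(\mathbf{a},\mathbf{b},\mathbf{c})}=(\mathbf{b}-\mathbf{a})\wedge(\mathbf{c}-\mathbf{a})$, which is then invertible in $\mathbb{G}_2$, and the multi-difference vector $$\mathbf{\Delta}f_{(\mathbf{a},\mathbf{b},\mathbf{c})}=[f(\mathbf{b})-f(\mathbf{a})](\mathbf{c}-\mathbf{a})-[f(\mathbf{c})-f(\mathbf{a})](\mathbf{b}-\mathbf{a}).$$ The mirrored point is the orthogonal reflection $\bar{\mathbf{a}}=\mathbf{b}+(\mathbf{c}-\mathbf{b})(\mathbf{a}-\mathbf{b})(\mathbf{c}-\mathbf{b})^{-1}=2\mathbf{b}-2\frac{(\mathbf{c}-\mathbf{b})\cdot(\mathbf{b}-\mathbf{a})}{|\mathbf{c}-\mathbf{b}|^2}(\mathbf{c}-\mathbf{b})-\mathbf{a}$.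 The mean multi-difference vector is $$\overline{\mathbf{\Delta}}f_{(\mathbf{a},\mathbf{b},\mathbf{c})}=\tfrac12\Big(\mathbf{\Delta}f_{(\mathbf{a},\mathbf{b},\mathbf{c})}-\mathbf{\Delta}f_{(\bar{\mathbf{a}},\mathbf{b},\mathbf{c})}\Big).$$ *)

theory Defs
  imports "HOL-Analysis.Analysis"
begin

text \<open>
  The Clifford algebra of the Euclidean plane, by coordinates with respect to
  the basis \<open>1, e\<^sub>1, e\<^sub>2, e\<^sub>1e\<^sub>2\<close>, where \<open>e\<^sub>1, e\<^sub>2\<close> is the standard orthonormal basis.
  The multiplication table is the one forced by \<open>e\<^sub>1e\<^sub>1 = e\<^sub>2e\<^sub>2 = 1\<close> and \<open>e\<^sub>1e\<^sub>2 = - e\<^sub>2e\<^sub>1\<close>;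
  the lemmas \<open>of_vec_square\<close>, \<open>dim_clifford2\<close> and \<open>clifford2_universal\<close> confirm
  that this is the Clifford algebra.
\<close>

codatatype clifford2 = Cl (c0: real) (c1: real) (c2: real) (c12: real)

lemma clifford2_eq_iff: "x = y \<longleftrightarrow> c0 x = c0 y \<and> c1 x = c1 y \<and> c2 x = c2 y \<and> c12 x = c12 y"
  by (auto intro: clifford2.expand)

instantiation clifford2 :: real_algebra_1
begin

primcorec zero_clifford2 where
  "c0 0 = 0" | "c1 0 = 0" | "c2 0 = 0" | "c12 0 = 0"

primcorec one_clifford2 where
  "c0 1 = 1" | "c1 1 = 0" | "c2 1 = 0" | "c12 1 = 0"

primcorec plus_clifford2 where
  "c0 (x + y) = c0 x + c0 y"
| "c1 (x + y) = c1 x + c1 y"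
| "c2 (x + y) = c2 x + c2 y"
| "c12 (x + y) = c12 x + c12 y"

primcorec uminus_clifford2 where
  "c0 (- x) = - c0 x" | "c1 (- x) = - c1 x" | "c2 (- x) = - c2 x" | "c12 (- x) = - c12 x"

primcorec minus_clifford2 where
  "c0 (x - y) = c0 x - c0 y"
| "c1 (x - y) = c1 x - c1 y"
| "c2 (x - y) = c2 x - c2 y"
| "c12 (x - y) = c12 x - c12 y"

primcorec scaleR_clifford2 where
  "c0 (scaleR r x) = r * c0 x"
| "c1 (scaleR r x) = r * c1 x"
| "c2 (scaleR r x) = r * c2 x"
| "c12 (scaleR r x) = r * c12 x"

primcorec times_clifford2 where
  "c0 (x * y) = c0 x * c0 y + c1 x * c1 y + c2 x * c2 y - c12 x * c12 y"
| "c1 (x * y) = c0 x * c1 y + c1 x * c0 y - c2 x * c12 y + c12 x * c2 y"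
| "c2 (x * y) = c0 x * c2 y + c2 x * c0 y + c1 x * c12 y - c12 x * c1 y"
| "c12 (x * y) = c0 x * c12 y + c12 x * c0 y + c1 x * c2 y - c2 x * c1 y"

instance
  by standard (auto simp: clifford2_eq_iff algebra_simps)

end

text \<open>
  The algebra has zero divisors, so \<open>inverse\<close> is the two-sided inverse where one
  exists and \<open>0\<close> elsewhere; \<open>x / y\<close> multiplies by the inverse on the right.
\<close>

instantiation clifford2 :: inverse
begin

definition inverse_clifford2_def:
  "inverse x = (if \<exists>y. x * y = 1 \<and> y * x = 1 then THE y. x * y = 1 \<and> y * x = 1 else 0)"
  for x :: clifford2

definition divide_clifford2_def:
  "x div y = x * inverse y" for x y :: clifford2

instance ..

end

lemma clifford2_inverse_unique:
  fixes x y :: clifford2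
  assumes "x * y = 1" "y * x = 1"
  shows "inverse x = y"
proof -
  have u: "z = y" if "x * z = 1 \<and> z * x = 1" for z
  proof -
    have "z = (y * x) * z" using assms by simp
    also have "\<dots> = y" using that by (simp add: mult.assoc)
    finally show ?thesis .
  qed
  have "(THE y. x * y = 1 \<and> y * x = 1) = y"
    by (rule the_equality) (use assms in blast, rule u)
  then show ?thesis
    unfolding inverse_clifford2_def using assms by (metis (mono_tags, lifting))
qed

definition of_vec :: "real^2 \<Rightarrow> clifford2" where
  "of_vec v = Cl 0 (v $ 1) (v $ 2) 0"

lemma of_vec_sel [simp]:
  "c0 (of_vec v) = 0" "c1 (of_vec v) = v $ 1" "c2 (of_vec v) = v $ 2" "c12 (of_vec v) = 0"
  by (simp_all add: of_vec_def)

lemma of_real_sel [simp]: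
  "c0 (of_real r) = r" "c1 (of_real r) = 0" "c2 (of_real r) = 0" "c12 (of_real r) = 0"
  by (simp_all add: of_real_def)

lemma linear_of_vec: "linear of_vec"
  by (rule linearI) (simp_all add: clifford2_eq_iff)

lemma inj_of_vec: "inj of_vec"
  by (rule injI) (simp add: clifford2_eq_iff vec_eq_iff forall_2)

lemma of_vec_square: "of_vec v * of_vec v = of_real (v \<bullet> v)"
  by (simp add: clifford2_eq_iff inner_vec_def sum_2)

lemma clifford2_expansion:
  "x = c0 x *\<^sub>R 1 + c1 x *\<^sub>R of_vec (axis 1 1) + c2 x *\<^sub>R of_vec (axis 2 1)
       + c12 x *\<^sub>R (of_vec (axis 1 1) * of_vec (axis 2 1))"
  by (simp add: clifford2_eq_iff axis_def)

lemma dim_clifford2: "dim (UNIV :: clifford2 set) = 4"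
proof -
  let ?a = "of_vec (axis 1 1)" and ?b = "of_vec (axis 2 1)"
  let ?B = "{1, ?a, ?b, ?a * ?b}"
  have ne: "1 \<noteq> ?a" "1 \<noteq> ?b" "1 \<noteq> ?a * ?b" "?a \<noteq> ?b" "?a \<noteq> ?a * ?b" "?b \<noteq> ?a * ?b"
    by (auto simp: clifford2_eq_iff axis_def)
  have card: "card ?B = 4" using ne by auto
  have "independent ?B"
  proof (rule independent_if_scalars_zero)
    fix u x assume s: "(\<Sum>x\<in>?B. u x *\<^sub>R x) = 0" and x: "x \<in> ?B"
    have "u 1 *\<^sub>R 1 + (u ?a *\<^sub>R ?a + (u ?b *\<^sub>R ?b + u (?a * ?b) *\<^sub>R (?a * ?b))) = 0"
      using s ne by auto
    then have "u 1 = 0 \<and> u ?a = 0 \<and> u ?b = 0 \<and> u (?a * ?b) = 0"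
      by (simp add: clifford2_eq_iff axis_def)
    then show "u x = 0" using x by auto
  qed simp
  moreover have "x \<in> span ?B" for x
    by (subst clifford2_expansion) (intro span_add span_scale span_base; simp)
  then have "UNIV \<subseteq> span ?B" by blast
  ultimately show ?thesis
    using dim_unique[of ?B UNIV 4] card by auto
qed

lemma clifford2_universal:
  fixes j :: "real^2 \<Rightarrow> 'a :: real_algebra_1"
  assumes j: "linear j" and sq: "\<And>v. j v * j v = of_real (v \<bullet> v)"
  shows "\<exists>!h. linear h \<and> h 1 = 1 \<and> (\<forall>x y. h (x * y) = h x * h y) \<and> (\<forall>v. h (of_vec v) = j v)"
proof -
  let ?e = "axis 1 1 :: real^2" and ?g = "axis 2 1 :: real^2"
  define p q where "p = j ?e" and "q = j ?g"
  have pp: "p * p = 1" and qq: "q * q = 1"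
    unfolding p_def q_def sq by (simp_all add: inner_axis_axis)
  have "(p + q) * (p + q) = 2"
    unfolding p_def q_def linear_add[OF j, symmetric] sq
    by (simp add: inner_vec_def sum_2 axis_def)
  moreover have "(p + q) * (p + q) = 2 + (q * p + p * q)"
    by (simp only: distrib_left distrib_right pp qq one_add_one[symmetric] ac_simps)
  ultimately have "q * p + p * q = 0"
    by simp
  then have qp: "q * p = - (p * q)"
    by (simp add: eq_neg_iff_add_eq_0)
  have jv: "j v = v $ 1 *\<^sub>R p + v $ 2 *\<^sub>R q" for v
  proof -
    have "v = v $ 1 *\<^sub>R ?e + v $ 2 *\<^sub>R ?g"
      by (simp add: vec_eq_iff forall_2 axis_def)
    then have "j v = j (v $ 1 *\<^sub>R ?e + v $ 2 *\<^sub>R ?g)" by simp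
    then show ?thesis
      by (simp add: p_def q_def linear_add[OF j] linear_scale[OF j])
  qed
  have t: "p * (p * z) = z" "q * (q * z) = z" "q * (p * z) = - (p * (q * z))" for z
    by (simp_all flip: mult.assoc add: pp qq qp)
  define h where "h x = c0 x *\<^sub>R 1 + c1 x *\<^sub>R p + c2 x *\<^sub>R q + c12 x *\<^sub>R (p * q)" for x
  have "linear h"
    by (rule linearI) (simp_all add: h_def algebra_simps)
  moreover have "h 1 = 1" by (simp add: h_def)
  moreover have "h (x * y) = h x * h y" for x y
    by (simp add: h_def algebra_simps pp qq qp t)
  moreover have "h (of_vec v) = j v" for v by (simp add: h_def jv)
  moreover have "k = h"
    if "linear k" "k 1 = 1" "\<forall>x y. k (x * y) = k x * k y" "\<forall>v. k (of_vec v) = j v" for k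
  proof
    fix x show "k x = h x"
      by (subst clifford2_expansion)
        (simp only: linear_add[OF that(1)] linear_scale[OF that(1)] that h_def p_def q_def)
  qed
  ultimately show ?thesis by blast
qed

lemma inverse_of_vec:
  assumes "v \<noteq> 0"
  shows "inverse (of_vec v) = of_vec ((1 / (norm v)\<^sup>2) *\<^sub>R v)"
proof -
  have "v $ 1 * v $ 1 + v $ 2 * v $ 2 = (norm v)\<^sup>2"
    by (simp add: power2_norm_eq_inner inner_vec_def sum_2)
  then have n: "v $ 1 * v $ 1 / (norm v)\<^sup>2 + v $ 2 * v $ 2 / (norm v)\<^sup>2 = 1"
    using assms by (simp only: add_divide_distrib[symmetric]) simp
  show ?thesis
    by (rule clifford2_inverse_unique; unfold clifford2_eq_iff; simp add: n)
qed

lemma of_real_divide_of_vec: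
  assumes "v \<noteq> 0"
  shows "of_real \<alpha> / of_vec v = of_vec ((\<alpha> / (norm v)\<^sup>2) *\<^sub>R v)"
  unfolding divide_clifford2_def inverse_of_vec[OF assms] clifford2_eq_iff by simp

definition wedge :: "real^2 \<Rightarrow> real^2 \<Rightarrow> clifford2" where
  "wedge u v = (1/2) *\<^sub>R (of_vec u * of_vec v - of_vec v * of_vec u)"

definition Delta :: "real^2 \<Rightarrow> real^2 \<Rightarrow> real^2 \<Rightarrow> clifford2" where
  "Delta a b c = wedge (b - a) (c - a)"

lemma Delta_invertible:
  assumes "\<not> collinear {a, b, c}"
  shows "Delta a b c * inverse (Delta a b c) = 1" "inverse (Delta a b c) * Delta a b c = 1"
proof -
  define d where "d = (b - a) $ 1 * (c - a) $ 2 - (b - a) $ 2 * (c - a) $ 1"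
  have D: "Delta a b c = Cl 0 0 0 d"
    by (simp add: Delta_def wedge_def clifford2_eq_iff d_def)
  have "d \<noteq> 0"
  proof
    assume "d = 0"
    define u v where "u = b - a" and "v = c - a"
    have uv: "u $ 1 * v $ 2 = u $ 2 * v $ 1"
      using \<open>d = 0\<close> by (simp add: d_def u_def v_def)
    have c: "\<forall>i j. u $ i * v $ j = v $ i * u $ j"
      unfolding forall_2 using uv by (simp add: mult.commute)
    have k: "v = (v $ i / u $ i) *\<^sub>R u" if i: "u $ i \<noteq> 0" for i
    proof -
      have "v $ j = (v $ i / u $ i) * u $ j" for j
        using i c[rule_format, of i j] by (simp add: nonzero_eq_divide_eq mult.commute)
      then show ?thesis unfolding vec_eq_iff vector_scaleR_component real_scaleR_def by blast
    qed
    have "u = 0 \<or> (\<exists>k. v = k *\<^sub>R u)"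
    proof (cases "u = 0")
      case False
      then obtain i where "u $ i \<noteq> 0" by (auto simp: vec_eq_iff)
      then show ?thesis using k by blast
    qed simp
    then have "collinear {0, u, v}"
      unfolding collinear_lemma by blast
    then have "collinear {b, a, c}"
      using collinear_3[of b a c] by (simp add: u_def v_def)
    then show False using assms by (simp add: insert_commute)
  qed
  then have i: "Delta a b c * Cl 0 0 0 (- 1 / d) = 1" "Cl 0 0 0 (- 1 / d) * Delta a b c = 1"
    by (simp_all add: D clifford2_eq_iff)
  show "Delta a b c * inverse (Delta a b c) = 1" "inverse (Delta a b c) * Delta a b c = 1"
    by (simp_all only: clifford2_inverse_unique[OF i] i)
qed

definition multi_diff :: "(real^2 \<Rightarrow> real) \<Rightarrow> real^2 \<Rightarrow> real^2 \<Rightarrow> real^2 \<Rightarrow> real^2" where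
  "multi_diff f a b c = (f b - f a) *\<^sub>R (c - a) - (f c - f a) *\<^sub>R (b - a)"

text \<open>Orthogonal reflection of \<open>a\<close> through the line through \<open>b\<close> and \<open>c\<close>.\<close>

definition mirror :: "real^2 \<Rightarrow> real^2 \<Rightarrow> real^2 \<Rightarrow> real^2" where
  "mirror a b c =
     2 *\<^sub>R b - (2 * (((c - b) \<bullet> (b - a)) / (norm (c - b))\<^sup>2)) *\<^sub>R (c - b) - a"

lemma of_vec_mirror:
  assumes "b \<noteq> c"
  shows "of_vec (mirror a b c) =
    of_vec b + of_vec (c - b) * of_vec (a - b) * inverse (of_vec (c - b))"
proof -
  define w u where "w = c - b" and "u = a - b"
  have w: "w \<noteq> 0" using assms by (simp add: w_def)
  have n: "(norm w)\<^sup>2 = w $ 1 * w $ 1 + w $ 2 * w $ 2"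
    by (simp add: power2_norm_eq_inner inner_vec_def sum_2)
  have n0: "w $ 1 * w $ 1 + w $ 2 * w $ 2 \<noteq> 0" using w n by (metis norm_eq_zero power_eq_0_iff)
  have "w \<bullet> (b - a) = - (w \<bullet> u)" by (simp add: u_def inner_diff_right)
  then have m: "mirror a b c = b + (2 * ((w \<bullet> u) / (norm w)\<^sup>2)) *\<^sub>R w - u"
    by (simp add: mirror_def w_def[symmetric]) (simp add: u_def scaleR_2)
  show ?thesis
    unfolding m w_def[symmetric] u_def[symmetric] inverse_of_vec[OF w]
    using n0 by (simp add: clifford2_eq_iff n inner_vec_def sum_2 divide_simps)
      (auto simp: algebra_simps)
qed

definition mean_multi_diff :: "(real^2 \<Rightarrow> real) \<Rightarrow> real^2 \<Rightarrow> real^2 \<Rightarrow> real^2 \<Rightarrow> real^2" where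
  "mean_multi_diff f a b c = (1/2) *\<^sub>R (multi_diff f a b c - multi_diff f (mirror a b c) b c)"

definition mean_ratio :: "(real^2 \<Rightarrow> real) \<Rightarrow> real^2 \<Rightarrow> real^2 \<Rightarrow> real^2 \<Rightarrow> clifford2" where
  "mean_ratio f a b c = of_vec (mean_multi_diff f a b c) * inverse (Delta a b c)"

end

theory Submission imports Defs begin

text \<open>
  Write \<open>w = c - b\<close> for the side and \<open>m = mirror a b c - a\<close> for the displacement of the
  reflected vertex. Both differences of values of \<open>f\<close> enter the mean multi-difference
  linearly, one along each of these vectors:
  \<open>mean_multi_diff f a b c = ((f (mirror a b c) - f a) w - (f c - f b) m) / 2\<close>.
  The reflection makes \<open>m\<close> orthogonal to \<open>w\<close>, so that \<open>w\<close> and \<open>m\<close> anticommute in the Clifford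
  algebra, and \<open>m / 2\<close> is the height of the triangle on the side \<open>w\<close>. Hence
  \<open>Delta a b c = m w / 2 = - w m / 2\<close> (lemma \<open>Delta_eq_displacement_side\<close>), with inverse
  \<open>2 w\<^sup>-\<^sup>1 m\<^sup>-\<^sup>1 = - 2 m\<^sup>-\<^sup>1 w\<^sup>-\<^sup>1\<close>. Multiplying the first term of the mean multi-difference by the
  first form of the inverse cancels \<open>w\<close> and leaves division by \<open>m\<close>; multiplying the second
  term by the second form cancels \<open>m\<close> and leaves division by \<open>w\<close>.
\<close>

lemma of_vec_inverse:
  assumes "v \<noteq> 0"
  shows of_vec_right_inverse: "of_vec v * inverse (of_vec v) = 1"
    and of_vec_left_inverse: "inverse (of_vec v) * of_vec v = 1"
proof -
  have "of_vec ((1 / (norm v)\<^sup>2) *\<^sub>R v) = (1 / (norm v)\<^sup>2) *\<^sub>R of_vec v"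
    by (rule linear_scale[OF linear_of_vec])
  moreover have "of_vec v * of_vec v = (norm v)\<^sup>2 *\<^sub>R 1"
    by (simp add: of_vec_square power2_norm_eq_inner of_real_def)
  ultimately show "of_vec v * inverse (of_vec v) = 1" "inverse (of_vec v) * of_vec v = 1"
    using assms by (simp_all add: inverse_of_vec)
qed

lemma of_vec_anticommute:
  assumes "u \<bullet> v = 0"
  shows "of_vec v * of_vec u = - (of_vec u * of_vec v)"
  using assms by (simp add: clifford2_eq_iff inner_vec_def sum_2 algebra_simps)

lemma mirror_displacement_orthogonal: "(mirror a b c - a) \<bullet> (c - b) = 0"
proof -
  define w k where "w = c - b" and "k = (w \<bullet> (b - a)) / (norm w)\<^sup>2"
  have m: "mirror a b c - a = 2 *\<^sub>R ((b - a) - k *\<^sub>R w)"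
    by (simp add: mirror_def w_def k_def algebra_simps scaleR_2)
  have "k * (w \<bullet> w) = w \<bullet> (b - a)"
    by (cases "w = 0") (simp_all add: k_def power2_norm_eq_inner)
  then have "((b - a) - k *\<^sub>R w) \<bullet> w = 0"
    unfolding inner_diff_left[of "b - a" "k *\<^sub>R w" w] by (simp add: inner_commute)
  then show ?thesis
    unfolding m w_def[symmetric] by simp
qed

text \<open>
  The bivector of a triangle depends on the vertex only modulo translations along the
  opposite side, so \<open>b - a\<close> may be replaced by the height, which is half the displacement. For
  orthogonal vectors the wedge is the Clifford product.
\<close>

lemma Delta_eq_displacement_side:
  "Delta a b c = (1/2) *\<^sub>R (of_vec (mirror a b c - a) * of_vec (c - b))"
proof -
  define m k where "m = mirror a b c - a"
    and "k = ((c - b) \<bullet> (b - a)) / (norm (c - b))\<^sup>2"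
  have "b - a = (1/2) *\<^sub>R m + k *\<^sub>R (c - b)"
    by (simp add: m_def mirror_def k_def algebra_simps scaleR_2 flip: scaleR_add_left)
      (simp add: vec_eq_iff field_simps)
  moreover have "wedge ((1/2) *\<^sub>R m + k *\<^sub>R w) w = (1/2) *\<^sub>R wedge m w" for w
    by (simp add: wedge_def clifford2_eq_iff algebra_simps)
  ultimately have "wedge (b - a) (c - b) = (1/2) *\<^sub>R wedge m (c - b)"
    by metis
  moreover have "Delta a b c = wedge (b - a) (c - b)"
    by (simp add: Delta_def wedge_def clifford2_eq_iff algebra_simps)
  moreover have "wedge m (c - b) = of_vec m * of_vec (c - b)"
    using of_vec_anticommute[OF mirror_displacement_orthogonal[of a b c]]
    by (simp add: wedge_def m_def flip: scaleR_2)
  ultimately show ?thesis by (simp add: m_def)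
qed

text \<open>
  Expanding, \<open>multi_diff f a b c = f b (c - a) - f c (b - a) - f a (c - b)\<close>, so in the
  difference of the two multi-differences only the displacement of the first vertex survives
  next to \<open>f b\<close> and \<open>f c\<close>.
\<close>

lemma mean_multi_diff_eq:
  "mean_multi_diff f a b c = (1/2) *\<^sub>R
     ((f (mirror a b c) - f a) *\<^sub>R (c - b) - (f c - f b) *\<^sub>R (mirror a b c - a))"
  unfolding mean_multi_diff_def multi_diff_def by (simp add: algebra_simps)

theorem proposition3p1:
  fixes f :: "real^2 \<Rightarrow> real" and \<Omega> :: "(real^2) set" and a b c :: "real^2"
  assumes "a \<in> \<Omega>" and "b \<in> \<Omega>" and "c \<in> \<Omega>"
    and "\<not> collinear {a, b, c}"
    and "mirror a b c \<in> \<Omega>"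
  shows "mean_ratio f a b c =
      of_real (f (mirror a b c) - f a) / of_vec (mirror a b c - a)
    + of_real (f c - f b) / of_vec (c - b)"
proof -
  define p q where "p = f (mirror a b c) - f a" and "q = f c - f b"
  define W M where "W = of_vec (c - b)" and "M = of_vec (mirror a b c - a)"
  have anti: "W * M = - (M * W)"
    unfolding W_def M_def by (rule of_vec_anticommute[OF mirror_displacement_orthogonal])
  have D: "Delta a b c = (1/2) *\<^sub>R (M * W)"
    unfolding M_def W_def by (rule Delta_eq_displacement_side)
  \<comment> \<open>A vanishing side or displacement would make the bivector zero, but it is invertible.\<close>
  have "Delta a b c \<noteq> 0"
    using Delta_invertible(1)[OF assms(4)] by auto
  then have "M \<noteq> 0" "W \<noteq> 0"
    unfolding D by auto
  then have "mirror a b c - a \<noteq> 0" "c - b \<noteq> 0"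
    unfolding M_def W_def using linear_0[OF linear_of_vec] by metis+
  then have MM: "M * inverse M = 1" "inverse M * M = 1"
    and WW: "W * inverse W = 1" "inverse W * W = 1"
    unfolding M_def W_def by (auto intro: of_vec_inverse)
  have cancel: "M * (inverse M * z) = z" "inverse M * (M * z) = z"
    "W * (inverse W * z) = z" "inverse W * (W * z) = z" for z
    by (simp_all add: MM WW flip: mult.assoc)
  have D': "Delta a b c = - ((1/2) *\<^sub>R (W * M))"
    by (simp add: D anti)
  have inv1: "inverse (Delta a b c) = 2 *\<^sub>R (inverse W * inverse M)"
    by (rule clifford2_inverse_unique) (simp_all add: D mult.assoc cancel MM WW)
  have inv2: "inverse (Delta a b c) = - (2 *\<^sub>R (inverse M * inverse W))"
    by (rule clifford2_inverse_unique) (simp_all add: D' mult.assoc cancel MM WW)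
  have "mean_ratio f a b c
      = (p/2) *\<^sub>R (W * inverse (Delta a b c)) - (q/2) *\<^sub>R (M * inverse (Delta a b c))"
    unfolding mean_ratio_def mean_multi_diff_eq W_def M_def p_def q_def
    by (simp add: linear_scale[OF linear_of_vec] linear_diff[OF linear_of_vec]
        left_diff_distrib scaleR_diff_right)
  also have "W * inverse (Delta a b c) = 2 *\<^sub>R inverse M"
    unfolding inv1 by (simp add: cancel)
  also have "M * inverse (Delta a b c) = - (2 *\<^sub>R inverse W)"
    unfolding inv2 by (simp add: cancel)
  finally have "mean_ratio f a b c = of_real p / M + of_real q / W"
    by (simp add: divide_clifford2_def of_real_def)
  then show ?thesis
    unfolding p_def q_def W_def M_def .
qed

end
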